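(* Let $a<b$ be real numbers, $T=b-a$, $t\in(a,b)$ fixed, $n$ a positive integer. Let $$K(x)=\frac{\cos\frac{\pi(x-t)}{T}}{\sin^3\frac{\pi(x-t)}{T}},\qquad e_m(x)=e^{\mathrm{i}2m\pi x/T},\qquad f_m(x)=K(x)e_m(x),\qquad m=0,\pm1,\pm2,\ldots.$$ Define numbers $B_{m,n}$ for all integers $m$ and positive integers $n$ as follows: $B_{0,n}=0$; $B_{-m,n}=-B_{m,n}$ for all $m$; and, given $m\ge0$, if $k\ge0$ and $0\le r\le n-1$ are the unique integers with $m=kn+r$, then $$B_{m,n}=B_{kn+r,n}=B_{r,n}=\tfrac{2}{3}rn^2-2r^2n+\tfrac{4}{3}r^3 .$$ Then, for every integer $m$, the quadrature formulas $\widehat{T}^{(s)}_n[f_m]$, $s=0,1,2$, satisfy $$\widehat{T}^{(0)}_n[f_m]=\mathrm{i}\,\frac{T}{n}\Big(B_{m,n}-\tfrac{2}{3}mn^2-\tfrac{4}{3}m^3\Big)e_m(t),$$ $$\widehat{T}^{(1)}_n[f_m]=\mathrm{i}\,\frac{T}{n}\Big([B_{m,2n}-B_{m,n}]-2mn^2\Big)e_m(t),$$ $$\widehat{T}^{(2)}_n[f_m]=\mathrm{i}\,\frac{T}{n}\Big(2[B_{m,2n}-B_{m,n}]-\tfrac{1}{2}[B_{m,4n}-B_{m,2n}]\Big)e_m(t).$$ Moreover, $|B_{m,n}|\le\max_{0\le i\le n-1}|B_{i,n}|$ independently of $m$; hence $\{B_{m,n}\}_{m=-\infty}^{\infty}$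 is a bounded sequence for each fixed $n$.
   Context: For a $T$-periodic function $f$ which is $C^\infty$ on $\mathbb{R}\setminus\{t+kT:\ k\in\mathbb{Z}\}$ and such that $g(x)=(x-t)^3f(x)$ (extended to $x=t$) is $C^\infty$ on $[a,b]$, the quadrature formulas are, with $h=T/n$, $$\widehat{T}^{(0)}_n[f]=h\sum_{j=1}^{n-1}f(t+jh)-\frac{\pi^2}{3}g'(t)h^{-1}+\frac16 g'''(t)h,$$ $$\widehat{T}^{(1)}_n[f]=h\sum_{j=1}^{n}f(t+jh-h/2)-\pi^2g'(t)h^{-1},$$ $$\widehat{T}^{(2)}_n[f]=2h\sum_{j=1}^{n}f(t+jh-h/2)-\frac h2\sum_{j=1}^{2n}f(t+jh/2-h/4).$$ *)

theory Defs
  imports "HOL-Analysis.Analysis"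
begin

(* The function g(x) = (x - t)^3 f(x), extended to x = t by its limit there.
   The value of f at t itself is irrelevant. *)
definition regular_part :: "real \<Rightarrow> (real \<Rightarrow> complex) \<Rightarrow> real \<Rightarrow> complex" where
  "regular_part t f x =
     (if x = t then Lim (at t) (\<lambda>y. of_real ((y - t) ^ 3) * f y)
      else of_real ((x - t) ^ 3) * f x)"

definition nth_vector_derivative :: "nat \<Rightarrow> (real \<Rightarrow> complex) \<Rightarrow> real \<Rightarrow> complex" where
  "nth_vector_derivative k g = ((\<lambda>u x. vector_derivative u (at x)) ^^ k) g"

definition quad0 :: "real \<Rightarrow> real \<Rightarrow> nat \<Rightarrow> (real \<Rightarrow> complex) \<Rightarrow> complex" where
  "quad0 T t n f =
     (let h = T / real n; g = regular_part t f in
        of_real h * (\<Sum>j = 1..n - 1. f (t + real j * h))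
        - of_real (pi\<^sup>2 / 3) * nth_vector_derivative 1 g t * of_real (inverse h)
        + of_real (1 / 6) * nth_vector_derivative 3 g t * of_real h)"

definition quad1 :: "real \<Rightarrow> real \<Rightarrow> nat \<Rightarrow> (real \<Rightarrow> complex) \<Rightarrow> complex" where
  "quad1 T t n f =
     (let h = T / real n; g = regular_part t f in
        of_real h * (\<Sum>j = 1..n. f (t + real j * h - h / 2))
        - of_real (pi\<^sup>2) * nth_vector_derivative 1 g t * of_real (inverse h))"

definition quad2 :: "real \<Rightarrow> real \<Rightarrow> nat \<Rightarrow> (real \<Rightarrow> complex) \<Rightarrow> complex" where
  "quad2 T t n f =
     (let h = T / real n in
        of_real (2 * h) * (\<Sum>j = 1..n. f (t + real j * h - h / 2))
        - of_real (h / 2) * (\<Sum>j = 1..2 * n. f (t + real j * h / 2 - h / 4)))"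

definition kernel3 :: "real \<Rightarrow> real \<Rightarrow> real \<Rightarrow> real" where
  "kernel3 T t x = cos (pi * (x - t) / T) / sin (pi * (x - t) / T) ^ 3"

definition e_fun :: "real \<Rightarrow> int \<Rightarrow> real \<Rightarrow> complex" where
  "e_fun T m x = exp (\<i> * of_real (2 * of_int m * pi * x / T))"

definition f_fun :: "real \<Rightarrow> real \<Rightarrow> int \<Rightarrow> real \<Rightarrow> complex" where
  "f_fun T t m x = of_real (kernel3 T t x) * e_fun T m x"

(* The values for nonnegative index: r = m mod n is the remainder in m = k n + r. *)
definition B_nonneg :: "nat \<Rightarrow> nat \<Rightarrow> real" where
  "B_nonneg m n =
     (let r = real (m mod n) in
        2 / 3 * r * real n ^ 2 - 2 * r ^ 2 * real n + 4 / 3 * r ^ 3)"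

definition B :: "int \<Rightarrow> nat \<Rightarrow> real" where
  "B m n = (if m \<ge> 0 then B_nonneg (nat m) n else - B_nonneg (nat (- m)) n)"

(* The properties by which B is characterised. *)

lemma B_0 [simp]: "B 0 n = 0"
  by (simp add: B_def B_nonneg_def Let_def)

lemma B_minus: "B (- m) n = - B m n"
  by (cases "m = 0") (auto simp: B_def B_nonneg_def)

lemma B_quotient_remainder:
  fixes k n r :: nat
  assumes "r < n"
  shows "B (int (k * n + r)) n =
           2 / 3 * real r * real n ^ 2 - 2 * real r ^ 2 * real n + 4 / 3 * real r ^ 3"
    and "B (int (k * n + r)) n = B (int r) n"
proof -
  have *: "B (int (k * n + r)) n = B_nonneg (k * n + r) n" for k
    unfolding B_def by (simp del: of_nat_add of_nat_mult)
  show "B (int (k * n + r)) n =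
           2 / 3 * real r * real n ^ 2 - 2 * real r ^ 2 * real n + 4 / 3 * real r ^ 3"
    using assms unfolding * by (simp add: B_nonneg_def Let_def)
  show "B (int (k * n + r)) n = B (int r) n"
    using assms *[of k] *[of 0] by (simp add: B_nonneg_def Let_def)
qed

end

(* With w = exp(2 pi i j / n) one has
     cos(pi j / n) / sin(pi j / n)^3 * (w - 1)^3 = - 4 i (w + w^2),
   so the third difference in m of S_n(m) = sum_{0<j<n} K(t + j h) w^m is a sum of geometric
   progressions, equal to 8 i for 0 <= m <= n - 3. The cubic i B_{m,n} has the same third
   difference, hence the two differ by a quadratic on 0..n. This quadratic vanishes at 0 and n and
   so is symmetric under m -> n - m; but S_n and B are both antisymmetric, so it is zero.
   Midpoint sums are S_{2n} - S_n. The derivative terms come from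
   z^3 cos(z) / sin(z)^3 = 1 + O(z^4), so that only the Taylor coefficients of e_m contribute. *)

theory Submission
  imports Defs
begin

section \<open>Derivatives at a point, read off from power series\<close>

text \<open>\<open>G\<close> is holomorphic near 0, so its derivative along the real line is the
  complex one. The conclusion has the shape of the hypothesis on \<open>g\<close>, which permits
  iteration.\<close>

lemma vector_derivative_eventually_fps:
  fixes G :: "complex \<Rightarrow> complex"
  assumes "G has_fps_expansion F" "\<forall>\<^sub>F x in nhds t. g x = G (of_real (x - t))"
  shows "\<forall>\<^sub>F x in nhds t. vector_derivative g (at x) = deriv G (of_real (x - t))"
proof -
  obtain s where s: "open s" "0 \<in> s" "G holomorphic_on s"
    using has_fps_expansion_imp_holomorphic[OF assms(1)] by metis
  have "((\<lambda>x. complex_of_real (x - t)) \<longlongrightarrow> 0) (nhds t)"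
    by (rule tendsto_eq_intros tendsto_ident_at refl filterlim_ident | simp)+
  then have "\<forall>\<^sub>F x in nhds t. complex_of_real (x - t) \<in> s"
    using s(1,2) by (rule topological_tendstoD)
  \<comment> \<open>Differentiating at x needs agreement on a whole neighbourhood of x, not only at
    x.\<close>
  moreover have "\<forall>\<^sub>F x in nhds t. \<forall>\<^sub>F y in nhds x. g y = G (of_real (y - t))"
    using assms(2) by (simp add: eventually_eventually)
  ultimately show ?thesis
  proof eventually_elim
    case (elim x)
    have "(G has_field_derivative deriv G (of_real (x - t))) (at (of_real x - of_real t))"
      using holomorphic_derivI[OF s(3,1) elim(1)] by simp
    then have "((\<lambda>z. G (z - of_real t)) has_field_derivative deriv G (of_real (x - t))) (at (of_real x))"
      using DERIV_shift[of G _ "of_real x" "- of_real t"] by simp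
    then have "((\<lambda>y. G (of_real y - of_real t)) has_vector_derivative deriv G (of_real (x - t))) (at x)"
      by (rule has_vector_derivative_real_field)
    moreover have "(g has_vector_derivative deriv G (of_real (x - t))) (at x) \<longleftrightarrow>
        ((\<lambda>y. G (of_real y - of_real t)) has_vector_derivative deriv G (of_real (x - t))) (at x)"
      using elim(2) by (intro has_vector_derivative_cong_ev)
        (auto elim: eventually_mono dest: eventually_nhds_x_imp_x)
    ultimately show ?case
      by (simp add: vector_derivative_at)
  qed
qed

lemma nth_vector_derivative_fps:
  fixes G :: "complex \<Rightarrow> complex"
  assumes "G has_fps_expansion F" "\<forall>\<^sub>F x in nhds t. g x = G (of_real (x - t))"
  shows "nth_vector_derivative k g t = fact k * fps_nth F k"
proof -
  have "((deriv ^^ k) G has_fps_expansion (fps_deriv ^^ k) F) \<and>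
      (\<forall>\<^sub>F x in nhds t. nth_vector_derivative k g x = (deriv ^^ k) G (of_real (x - t)))"
  proof (induction k)
    case (Suc k)
    then show ?case
      using vector_derivative_eventually_fps[of "(deriv ^^ k) G" _ "nth_vector_derivative k g" t]
      by (auto simp: nth_vector_derivative_def intro: has_fps_expansion_deriv)
  qed (use assms in \<open>simp add: nth_vector_derivative_def\<close>)
  then have "nth_vector_derivative k g t = fps_nth ((fps_deriv ^^ k) F) 0"
    by (auto simp: has_fps_expansion_def eval_fps_at_0 dest!: eventually_nhds_x_imp_x)
  then show ?thesis
    by (simp add: fps_0th_higher_deriv)
qed

text \<open>Without the exponential the series is (1 + O(z^4)) / \<alpha>^3, so its product with the
  exponential has the coefficients of the latter over \<alpha>^3 in degrees 1 and 3. The formula for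
  \<open>G\<close> excludes z = 0, where its right-hand side is 0 but the limit is 1 /
  \<alpha>^3.\<close>

lemma cos_over_sin_cubed_fps:
  fixes \<alpha> c :: complex
  assumes "\<alpha> \<noteq> 0"
  obtains G F where "G has_fps_expansion F"
    "\<And>z. z \<noteq> 0 \<Longrightarrow> G z = z ^ 3 * (cos (\<alpha> * z) / sin (\<alpha> * z) ^ 3) * exp (c * z)"
    "fps_nth F 1 = c / \<alpha> ^ 3" "fps_nth F 3 = c ^ 3 / (6 * \<alpha> ^ 3)"
proof -
  \<comment> \<open>This is sin(\<alpha> z) / z with the singularity removed; the exponent 1 matches
    the form of \<open>has_fps_expansion_shift\<close>.\<close>
  define s where "s = (\<lambda>z. if z = 0 then \<alpha> else sin (\<alpha> * z) / z ^ 1)"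
  define S where "S = fps_shift 1 (fps_sin \<alpha>)"
  have sS: "s has_fps_expansion S"
    unfolding s_def S_def by (intro has_fps_expansion_shift has_fps_expansion_sin)
      (auto simp: fps_sin_def fps_eq_iff assms dest!: spec[of _ 1] intro!: subdegree_geI)
  define I where "I = inverse S"
  have S_nth: "fps_nth S 0 = \<alpha>" "fps_nth S (Suc 0) = 0" "fps_nth S 2 = - (\<alpha> ^ 3 / 6)" "fps_nth S 3 = 0"
    by (simp_all add: S_def fps_sin_def fact_numeral numeral_3_eq_3[symmetric])
  have SI: "S * I = 1" unfolding I_def
    using assms by (intro inverse_mult_eq_1') (simp add: S_nth)
  have "fps_nth (S * I) 0 = 1" "fps_nth (S * I) 1 = 0" "fps_nth (S * I) 2 = 0" "fps_nth (S * I) 3 = 0"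
    unfolding SI by simp_all
  then have I_nth: "fps_nth I 0 = 1 / \<alpha>" "fps_nth I (Suc 0) = 0" "fps_nth I 2 = \<alpha> / 6" "fps_nth I 3 = 0"
    using assms by (simp_all add: fps_mult_nth numeral_2_eq_2 numeral_3_eq_3
      S_nth[unfolded numeral_2_eq_2 numeral_3_eq_3] field_simps)
  define J where "J = I * I * I"
  define Q where "Q = fps_cos \<alpha> * J"
  define F where "F = Q * fps_exp c"
  define G where "G = (\<lambda>z. cos (\<alpha> * z) * (inverse (s z) * inverse (s z) * inverse (s z)) * exp (c * z))"
  have G_F: "G has_fps_expansion F"
    unfolding G_def F_def Q_def J_def I_def
    using assms by (intro has_fps_expansion_mult has_fps_expansion_cos has_fps_expansion_exp
      has_fps_expansion_inverse sS) (simp_all add: S_nth)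
  have G_eq: "G z = z ^ 3 * (cos (\<alpha> * z) / sin (\<alpha> * z) ^ 3) * exp (c * z)" if "z \<noteq> 0" for z
    using that by (simp add: G_def s_def power3_eq_cube field_simps)
  have J_nth: "fps_nth J 0 = 1 / \<alpha> ^ 3" "fps_nth J (Suc 0) = 0"
    "fps_nth J 2 = 1 / (2 * \<alpha>)" "fps_nth J 3 = 0"
    using assms by (simp_all add: J_def fps_mult_nth numeral_2_eq_2 numeral_3_eq_3
      I_nth[unfolded numeral_2_eq_2 numeral_3_eq_3] field_simps)
  have cos_nth: "fps_nth (fps_cos \<alpha>) 0 = 1" "fps_nth (fps_cos \<alpha>) (Suc 0) = 0"
    "fps_nth (fps_cos \<alpha>) 2 = - (\<alpha> ^ 2 / 2)" "fps_nth (fps_cos \<alpha>) 3 = 0"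
    by (simp_all add: fps_cos_def)
  \<comment> \<open>In degree 2, the term 1 / (2 \<alpha>) from \<open>J\<close> cancels against
    -\<alpha>^2 / 2 times 1 / \<alpha>^3 from the cosine.\<close>
  have Q_nth: "fps_nth Q 0 = 1 / \<alpha> ^ 3" "fps_nth Q (Suc 0) = 0" "fps_nth Q 2 = 0" "fps_nth Q 3 = 0"
    using assms J_nth(1) by (simp_all add: Q_def fps_mult_nth numeral_2_eq_2 numeral_3_eq_3
      J_nth[unfolded numeral_2_eq_2 numeral_3_eq_3]
      cos_nth[unfolded numeral_2_eq_2 numeral_3_eq_3] field_simps)
  have "fps_nth F 1 = c / \<alpha> ^ 3" "fps_nth F 3 = c ^ 3 / (6 * \<alpha> ^ 3)"
    unfolding F_def by (simp_all add: fps_mult_nth fact_numeral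
      numeral_2_eq_2 numeral_3_eq_3 Q_nth[unfolded numeral_2_eq_2 numeral_3_eq_3] field_simps)
  then show thesis
    using that G_F G_eq by blast
qed

section \<open>Sums of the normalised kernel over equispaced nodes\<close>

text \<open>This is \<open>f_fun T t m\<close> at t + x T with the factor \<open>e_fun T m t\<close>
  split off, which removes T and t from the sums.\<close>

definition node :: "int \<Rightarrow> real \<Rightarrow> complex" where
  "node m x = of_real (cos (pi * x) / sin (pi * x) ^ 3) * cis (2 * pi * of_int m * x)"

(* The term j = 0 is 0 because node m 0 = 1/0 * 1 = 0. Including it makes S_{2n} split into
   S_n and the midpoint sum without a boundary case. *)
definition node_sum :: "nat \<Rightarrow> int \<Rightarrow> complex" where
  "node_sum n m = (\<Sum>j<n. node m (real j / real n))"

lemma node_0 [simp]: "node m 0 = 0"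
  by (simp add: node_def)

lemma cis_int_periodic: "cis (2 * pi * of_int k + x) = cis x"
  by (simp flip: cis_mult)

text \<open>The map x -> 1 - x negates the cosine and fixes the sine; negating m restores the
  exponential up to full turns.\<close>

lemma node_uminus: "node (- m) (1 - x) = - node m x"
proof -
  have "cis (2 * pi * of_int (- m) * (1 - x)) = cis (2 * pi * of_int (- m) + 2 * pi * of_int m * x)"
    by (simp add: algebra_simps)
  also have "\<dots> = cis (2 * pi * of_int m * x)"
    by (rule cis_int_periodic)
  finally show ?thesis
    by (simp add: node_def right_diff_distrib sin_diff cos_diff)
qed

lemma node_sum_eq_positive: "node_sum n m = (\<Sum>j = 1..n - 1. node m (real j / real n))"
proof -
  have "(\<Sum>j = 1..n - 1. node m (real j / real n)) = node_sum n m"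
    unfolding node_sum_def
    by (rule sum.mono_neutral_left) (auto simp: Suc_le_eq)
  then show ?thesis by simp
qed

text \<open>Reverses the order of the nodes by j -> n - j, which preserves the range 0 < j <
  n.\<close>

lemma node_sum_uminus: "node_sum n (- m) = - node_sum n m"
proof -
  have "node_sum n (- m) = (\<Sum>j = 1..n - 1. - node m (real j / real n))"
    unfolding node_sum_eq_positive
    by (rule sum.reindex_bij_witness[of _ "\<lambda>j. n - j" "\<lambda>j. n - j"])
      (auto simp: diff_divide_distrib node_uminus[of "- m", simplified])
  then show ?thesis
    by (simp add: node_sum_eq_positive sum_negf)
qed

lemma node_sum_add_period:
  assumes "n > 0"
  shows "node_sum n (m + k * int n) = node_sum n m"
proof -
  have "cis (2 * pi * of_int (m + k * int n) * (real j / real n)) =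
      cis (2 * pi * of_int m * (real j / real n))" for j
    using cis_int_periodic[of "k * int j" "2 * pi * of_int m * (real j / real n)"] assms
    by (simp add: field_simps)
  then show ?thesis
    by (simp add: node_sum_def node_def)
qed

text \<open>With w = cis(2 \<theta>), the cube of w - 1 = 2 i sin(\<theta>) cis(\<theta>) cancels
  the cubed sine, and the remaining cosine is absorbed into w + 1 = 2 cos(\<theta>)
  cis(\<theta>).\<close>

lemma cos_over_sin_cubed_cis:
  assumes "sin \<theta> \<noteq> 0"
  shows "complex_of_real (cos \<theta> / sin \<theta> ^ 3) * (cis (2 * \<theta>) - 1) ^ 3 =
    - 4 * \<i> * (cis (2 * \<theta>) + cis (2 * \<theta>) ^ 2)"
proof -
  have c: "cis (2 * \<theta>) = cis \<theta> ^ 2"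
    by (simp add: Complex.DeMoivre)
  have 1: "cis (2 * \<theta>) - 1 = 2 * \<i> * of_real (sin \<theta>) * cis \<theta>"
    by (simp add: complex_eq_iff cos_double_sin sin_double power2_eq_square)
  have 2: "cis (2 * \<theta>) + 1 = 2 * of_real (cos \<theta>) * cis \<theta>"
    by (simp add: complex_eq_iff cos_double_cos sin_double power2_eq_square)
  have "complex_of_real (cos \<theta> / sin \<theta> ^ 3) * (cis (2 * \<theta>) - 1) ^ 3 =
     - 4 * \<i> * (cis \<theta> ^ 2 * (2 * of_real (cos \<theta>) * cis \<theta>))"
    unfolding 1 using assms by (simp add: field_simps eval_nat_numeral)
  also have "\<dots> = - 4 * \<i> * (cis (2 * \<theta>) * (cis (2 * \<theta>) + 1))"
    unfolding 2 unfolding c ..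
  finally show ?thesis
    by (simp add: power2_eq_square algebra_simps)
qed

text \<open>For fixed x, m enters only as the exponent of w = cis(2 pi x), so the third difference
  in m is multiplication by (w - 1)^3.\<close>

lemma node_third_difference:
  assumes "sin (pi * x) \<noteq> 0"
  shows "node (m + 3) x - 3 * node (m + 2) x + 3 * node (m + 1) x - node m x =
    - 4 * \<i> * (cis (2 * pi * of_int (m + 1) * x) + cis (2 * pi * of_int (m + 2) * x))"
proof -
  define w where "w = cis (2 * pi * x)"
  define c where "c = cis (2 * pi * of_int m * x)"
  define K where "K = complex_of_real (cos (pi * x) / sin (pi * x) ^ 3)"
  have e: "cis (2 * pi * of_int (m + int k) * x) = c * w ^ k" for k
    by (simp add: w_def c_def Complex.DeMoivre cis_mult algebra_simps)
  have "K * (w - 1) ^ 3 = - 4 * \<i> * (w + w ^ 2)"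
    using cos_over_sin_cubed_cis[OF assms] by (simp add: K_def w_def mult.assoc)
  then have "c * (K * (w - 1) ^ 3) = c * (- 4 * \<i> * (w + w ^ 2))"
    by (rule arg_cong)
  moreover have node: "node (m + int k) x = K * (c * w ^ k)" for k
    unfolding node_def e K_def ..
  ultimately show ?thesis
    using node[of 3] node[of 2] node[of 1] node[of 0] e[of 1] e[of 2]
    by (simp add: eval_nat_numeral algebra_simps)
qed

text \<open>The powers of an n-th root of unity other than 1 sum to 0 over 0 <= j < n; dropping j =
  0 leaves -1.\<close>

lemma sum_cis_roots:
  assumes n: "n > 0" and "\<not> int n dvd p"
  shows "(\<Sum>j = 1..n - 1. cis (2 * pi * of_int p * (real j / real n))) = - 1"
proof -
  define w where "w = cis (2 * pi * (of_int p / real n))"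
  have "w \<noteq> 1"
  proof
    assume "w = 1"
    then have "cos (2 * pi * (of_int p / real n)) = 1"
      by (simp add: w_def complex_eq_iff)
    then obtain k :: int where "2 * pi * (of_int p / real n) = of_int k * 2 * pi"
      unfolding cos_one_2pi_int by blast
    then have "real_of_int p = of_int (k * int n)"
      using n by (simp add: field_simps)
    then show False
      using assms(2) by (metis dvd_triv_right of_int_eq_iff)
  qed
  moreover have "w ^ n = 1"
    using n cis_multiple_2pi[of "of_int p"] by (simp add: w_def Complex.DeMoivre)
  ultimately have "(\<Sum>j<n. w ^ j) = 0"
    by (simp add: sum_gp_strict)
  moreover have "{..<n} = insert 0 {1..n - 1}"
    using n by auto
  ultimately have "1 + (\<Sum>j = 1..n - 1. w ^ j) = 0"
    by simp
  moreover have "w ^ j = cis (2 * pi * of_int p * (real j / real n))" for j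
    by (simp add: w_def Complex.DeMoivre mult_ac)
  ultimately show ?thesis
    by (simp add: add_eq_0_iff)
qed

text \<open>Neither frequency is a multiple of n, so both exponential sums are -1, and -4 i times -2
  is the constant.\<close>

lemma node_sum_third_difference:
  assumes "n > 0" "\<not> int n dvd m + 1" "\<not> int n dvd m + 2"
  shows "node_sum n (m + 3) - 3 * node_sum n (m + 2) + 3 * node_sum n (m + 1) - node_sum n m = 8 * \<i>"
proof -
  have "sin (pi * (real j / real n)) \<noteq> 0" if "j \<in> {1..n - 1}" for j
  proof -
    have "sin (pi * (real j / real n)) > 0"
      using that by (intro sin_gt_zero) (auto simp: field_simps)
    then show ?thesis by simp
  qed
  note * = node_third_difference[OF this]
  have "node_sum n (m + 3) - 3 * node_sum n (m + 2) + 3 * node_sum n (m + 1) - node_sum n m =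
    (\<Sum>j = 1..n - 1. node (m + 3) (real j / real n) - 3 * node (m + 2) (real j / real n) +
      3 * node (m + 1) (real j / real n) - node m (real j / real n))"
    by (simp add: node_sum_eq_positive sum.distrib sum_subtractf sum_distrib_left)
  also have "\<dots> = (\<Sum>j = 1..n - 1. - 4 * \<i> * (cis (2 * pi * of_int (m + 1) * (real j / real n)) +
      cis (2 * pi * of_int (m + 2) * (real j / real n))))"
    by (intro sum.cong refl *)
  also have "\<dots> = - 4 * \<i> * (- 1 + - 1)"
    unfolding sum_distrib_left[symmetric] sum.distrib
      sum_cis_roots[OF assms(1,2)] sum_cis_roots[OF assms(1,3)] ..
  finally show ?thesis by simp
qed

section \<open>Identification of the node sums with \<open>B\<close>\<close>

text \<open>Factors as (2/3) x (n - x) (n - 2 x), hence is odd about n / 2; the leading coefficient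
  4/3 gives third difference 8. Unlike a remainder, x may take the value n.\<close>

definition B_cubic :: "nat \<Rightarrow> real \<Rightarrow> real" where
  "B_cubic n x = 2 / 3 * x * real n ^ 2 - 2 * x ^ 2 * real n + 4 / 3 * x ^ 3"

lemma B_cubic_reflect: "B_cubic n (real n - x) = - B_cubic n x"
  by (simp add: B_cubic_def power2_eq_square power3_eq_cube field_simps)

lemma node_sum_eq_B_cubic:
  assumes "m \<le> n"
  shows "node_sum n (int m) = \<i> * of_real (B_cubic n (real m))"
proof -
  define D where "D = (\<lambda>j. node_sum n (int j) - \<i> * of_real (B_cubic n (real j)))"
  \<comment> \<open>Both parts of \<open>D\<close> have third difference 8 i. As j + 3 <= n, the
    numbers j + 1 and j + 2 lie strictly between 0 and n, so n divides neither.\<close>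
  have D_step: "D (j + 3) = 3 * D (j + 2) - 3 * D (j + 1) + D j" if "j + 3 \<le> n" for j
  proof -
    have "n > 0" "\<not> int n dvd int j + 1" "\<not> int n dvd int j + 2"
      using that zdvd_not_zless[of "int j + 1" "int n"] zdvd_not_zless[of "int j + 2" "int n"] by auto
    from node_sum_third_difference[OF this]
    have node_step: "node_sum n (int j + 3) =
        8 * \<i> + 3 * node_sum n (int j + 2) - 3 * node_sum n (int j + 1) + node_sum n (int j)"
      by (simp add: algebra_simps)
    have B_step: "B_cubic n (real j + 3) =
        8 + 3 * B_cubic n (real j + 2) - 3 * B_cubic n (real j + 1) + B_cubic n (real j)"
      by (simp add: B_cubic_def field_simps eval_nat_numeral)
    have "D (j + 3) = node_sum n (int j + 3) - \<i> * of_real (B_cubic n (real j + 3))"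
      by (simp add: D_def)
    then show ?thesis
      unfolding node_step B_step by (simp add: D_def algebra_simps)
  qed
  (* The quadratic through (0, 0), (1, D 1), (2, D 2) is alpha j + beta j^2. *)
  define \<beta> where "\<beta> = (D 2 - 2 * D 1) / 2"
  define \<alpha> where "\<alpha> = D 1 - \<beta>"
  \<comment> \<open>At m = 0 antisymmetry makes the node sum its own negative.\<close>
  have D_0: "D 0 = 0"
    using node_sum_uminus[of n 0] by (simp add: D_def B_cubic_def)
  \<comment> \<open>A quadratic has zero third difference, so \<open>D_step\<close> propagates the
    agreement at 0, 1 and 2.\<close>
  have quad: "D j = \<alpha> * of_nat j + \<beta> * of_nat j ^ 2" if "j \<le> n" for j
    using that
  proof (induction j rule: less_induct)
    case (less j)
    consider "j = 0" | "j = 1" | "j = 2" | i where "j = i + 3"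
      by (metis add.commute add_2_eq_Suc' numeral_3_eq_3 One_nat_def add_Suc_right
          add.right_neutral numeral_2_eq_2 not0_implies_Suc)
    then show ?case
    proof cases
      case 4
      then show ?thesis
        using less.prems D_step[of i] less.IH[of i] less.IH[of "i + 1"] less.IH[of "i + 2"]
        by (simp add: algebra_simps power2_eq_square)
    qed (simp_all add: D_0 \<alpha>_def \<beta>_def field_simps)
  qed
  \<comment> \<open>Periodicity moves n - j to -j, where \<open>node_sum_uminus\<close>
    applies.\<close>
  have antisym: "D (n - j) = - D j" if "j \<le> n" for j
  proof (cases "n = 0")
    case False
    have "node_sum n (int (n - j)) = node_sum n (- int j + 1 * int n)"
      using that by simp
    also have "\<dots> = - node_sum n (int j)"
      using node_sum_add_period[of n "- int j" 1] False by (simp add: node_sum_uminus)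
    finally have "node_sum n (int (n - j)) = - node_sum n (int j)" .
    moreover have "B_cubic n (real (n - j)) = - B_cubic n (real j)"
      using that by (simp add: B_cubic_reflect)
    ultimately show ?thesis
      unfolding D_def by simp
  qed (use D_0 that in auto)
  have "D m = 0"
  proof (cases "n = 0")
    case False
    have "\<alpha> * of_nat n + \<beta> * of_nat n ^ 2 = 0"
      using quad[of n] antisym[of 0] D_0 by simp
    then have "of_nat n * (\<alpha> + \<beta> * of_nat n) = 0"
      by (simp add: power2_eq_square algebra_simps)
    then have \<alpha>: "\<alpha> = - \<beta> * of_nat n"
      using False by (simp add: eq_neg_iff_add_eq_0)
    \<comment> \<open>The quadratic is now \<beta> j (j - n), which j -> n - j leaves unchanged; by
      \<open>antisym\<close> it is also negated.\<close>
    then have "D (n - m) = D m"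
      unfolding quad[OF assms] quad[OF diff_le_self] \<alpha>
      using assms by (simp add: power2_eq_square algebra_simps)
    then show ?thesis
      using antisym[OF assms] by simp
  qed (use D_0 assms in simp)
  then show ?thesis
    by (simp add: D_def)
qed

text \<open>Shows that the sign rule for m < 0 amounts to plain periodicity: if -m has remainder r >
  0 then m has remainder n - r, and \<open>B_cubic\<close> is odd under this reflection.\<close>

lemma B_eq_B_cubic_mod:
  assumes "n > 0"
  shows "B m n = B_cubic n (of_int (m mod int n))"
proof (cases "m \<ge> 0")
  case True
  then have "real (nat m mod n) = of_int (m mod int n)"
    by (metis nat_0_le of_int_of_nat_eq zmod_int)
  with True show ?thesis
    by (simp add: B_def B_nonneg_def B_cubic_def Let_def)
next
  case False
  define r where "r = (- m) mod int n"
  have r: "real (nat (- m) mod n) = of_int r"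
    unfolding r_def using False
    by (metis nat_0_le neg_0_le_iff_le nle_le of_int_of_nat_eq zmod_int)
  have "m mod int n = (if r = 0 then 0 else int n - r)"
    unfolding r_def using zmod_zminus1_eq_if[of "- m" "int n"] by simp
  then show ?thesis
    using False by (simp add: B_cubic_reflect) (simp add: B_def B_nonneg_def Let_def r B_cubic_def)
qed

text \<open>Both sides depend only on m mod n, so the range 0..n suffices.\<close>

lemma node_sum_eq_B:
  assumes "n > 0"
  shows "node_sum n m = \<i> * of_real (B m n)"
proof -
  have "node_sum n m = node_sum n (m mod int n)"
    using node_sum_add_period[OF assms, of "m mod int n" "m div int n"] by simp
  moreover have "int (nat (m mod int n)) = m mod int n"
    "real (nat (m mod int n)) = of_int (m mod int n)" "nat (m mod int n) \<le> n"
    using assms by (simp_all add: nat_le_iff less_imp_le)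
  ultimately show ?thesis
    using node_sum_eq_B_cubic[of "nat (m mod int n)" n] B_eq_B_cubic_mod[OF assms, of m]
    by simp
qed

text \<open>Among the points j / (2 n), even j give the nodes of \<open>node_sum n\<close> and odd j
  the midpoints.\<close>

lemma sum_node_midpoints:
  assumes "n > 0"
  shows "(\<Sum>j = 1..n. node m ((real j - 1 / 2) / real n)) = node_sum (2 * n) m - node_sum n m"
proof -
  have split: "(\<Sum>j<2 * n. f j) = (\<Sum>j<n. f (2 * j)) + (\<Sum>j = 1..n. f (2 * j - 1))"
    for f :: "nat \<Rightarrow> complex"
    by (induction n) (simp_all add: algebra_simps)
  have "node_sum (2 * n) m = node_sum n m + (\<Sum>j = 1..n. node m (real (2 * j - 1) / real (2 * n)))"
    unfolding node_sum_def split by simp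
  moreover have "real (2 * j - 1) / real (2 * n) = (real j - 1 / 2) / real n" if "j \<in> {1..n}" for j
    using that by (simp add: field_simps)
  ultimately show ?thesis
    by simp
qed

lemma abs_B_le_Max:
  assumes "n > 0"
  shows "\<bar>B m n\<bar> \<le> Max ((\<lambda>i. \<bar>B (int i) n\<bar>) ` {0..n - 1})"
proof -
  define i where "i = nat (m mod int n)"
  have "int i = m mod int n" "i < n"
    using assms pos_mod_bound[of "int n" m] by (simp_all add: i_def nat_less_iff)
  then have "B m n = B (int i) n" "i \<in> {0..n - 1}"
    using assms by (auto simp: B_eq_B_cubic_mod)
  then show ?thesis
    by (intro Max_ge) auto
qed

section \<open>Evaluation of the quadrature formulas\<close>

lemma f_fun_eq_node:
  assumes "T > 0"
  shows "f_fun T t m (t + x * T) = node m x * e_fun T m t"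
proof -
  have "e_fun T m (t + x * T) = cis (2 * pi * of_int m * x) * e_fun T m t"
    using assms by (simp add: e_fun_def cis_conv_exp field_simps flip: exp_add)
  then show ?thesis
    using assms by (simp add: f_fun_def kernel3_def node_def)
qed

text \<open>Here g(x) is e_m(t) G(x - t), where \<alpha> = pi / T and c = 2 pi i m / T in
  \<open>cos_over_sin_cubed_fps\<close>. Then c / \<alpha>^3 = 2 i m T^2 / pi^2, while T cancels in
  (c / \<alpha>)^3 = -8 i m^3.\<close>

lemma nth_vector_derivative_regular_part:
  fixes T t :: real and m :: int
  assumes "T > 0"
  defines "g \<equiv> regular_part t (f_fun T t m)"
  shows "nth_vector_derivative 1 g t = 2 * \<i> * of_int m * of_real (T\<^sup>2 / pi\<^sup>2) * e_fun T m t"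
    and "nth_vector_derivative 3 g t = - 8 * \<i> * of_int m ^ 3 * e_fun T m t"
proof -
  define \<alpha> where "\<alpha> = complex_of_real (pi / T)"
  define c where "c = \<i> * of_real (2 * of_int m * pi / T)"
  have "\<alpha> \<noteq> 0"
    using assms by (simp add: \<alpha>_def)
  from cos_over_sin_cubed_fps[OF this, of c] obtain G F where GF: "G has_fps_expansion F"
    and G: "\<And>z. z \<noteq> 0 \<Longrightarrow> G z = z ^ 3 * (cos (\<alpha> * z) / sin (\<alpha> * z) ^ 3) * exp (c * z)"
    and F: "fps_nth F 1 = c / \<alpha> ^ 3" "fps_nth F 3 = c ^ 3 / (6 * \<alpha> ^ 3)"
    by metis
  define H where "H = (\<lambda>z. e_fun T m t * G z)"
  have HF: "H has_fps_expansion fps_const (e_fun T m t) * F"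
    unfolding H_def by (intro has_fps_expansion_cmult_left GF)
  have H: "of_real ((x - t) ^ 3) * f_fun T t m x = H (of_real (x - t))" if "x \<noteq> t" for x
  proof -
    define y where "y = x - t"
    have "f_fun T t m x = node m (y / T) * e_fun T m t"
      using f_fun_eq_node[OF assms(1), of t m "y / T"] assms(1) by (simp add: y_def)
    also have "node m (y / T) = cos (\<alpha> * of_real y) / sin (\<alpha> * of_real y) ^ 3 * exp (c * of_real y)"
      by (simp add: node_def \<alpha>_def c_def cis_conv_exp mult_ac flip: cos_of_real sin_of_real)
    finally show ?thesis
      using that G[of "of_real y"] by (simp add: H_def y_def mult_ac)
  qed
  \<comment> \<open>\<open>regular_part\<close> is defined at t by a limit; identifying this limit
    with \<open>H 0\<close> makes \<open>g\<close> agree with \<open>H\<close> at t as well.\<close>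
  have "((\<lambda>x. H (of_real (x - t))) \<longlongrightarrow> H 0) (at t)"
  proof -
    have "isCont H (complex_of_real (t - t))"
      using has_fps_expansion_imp_continuous[OF HF] by simp
    then have "isCont (\<lambda>x. H (complex_of_real (x - t))) t"
      by (intro continuous_at_compose[of t "\<lambda>x. complex_of_real (x - t)" H, unfolded o_def]) auto
    then show ?thesis
      by (simp add: isCont_def)
  qed
  then have "((\<lambda>x. of_real ((x - t) ^ 3) * f_fun T t m x) \<longlongrightarrow> H 0) (at t)"
    by (rule Lim_transform_eventually) (simp add: H eventually_at_filter del: of_real_diff of_real_power)
  then have "g x = H (of_real (x - t))" for x
    using H[of x] by (simp add: g_def regular_part_def tendsto_Lim)
  then have deriv: "nth_vector_derivative k g t = fact k * (e_fun T m t * fps_nth F k)" for k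
    using nth_vector_derivative_fps[OF HF, of g t k] by simp
  show "nth_vector_derivative 1 g t = 2 * \<i> * of_int m * of_real (T\<^sup>2 / pi\<^sup>2) * e_fun T m t"
    using assms(1) by (simp only: deriv F) (simp add: c_def \<alpha>_def field_simps eval_nat_numeral)
  show "nth_vector_derivative 3 g t = - 8 * \<i> * of_int m ^ 3 * e_fun T m t"
    using assms(1) by (simp only: deriv F) (simp add: c_def \<alpha>_def field_simps eval_nat_numeral)
qed

lemma sum_f_fun_nodes:
  assumes "T > 0"
  shows "(\<Sum>j = 1..n - 1. f_fun T t m (t + real j * (T / real n))) = node_sum n m * e_fun T m t"
  using f_fun_eq_node[OF assms, of t m "real j / real n" for j]
  by (simp add: node_sum_eq_positive sum_distrib_right)

lemma sum_f_fun_midpoints: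
  assumes "T > 0" "n > 0"
  shows "(\<Sum>j = 1..n. f_fun T t m (t + real j * (T / real n) - (T / real n) / 2)) =
    \<i> * of_real (B m (2 * n) - B m n) * e_fun T m t"
proof -
  have "t + real j * (T / real n) - (T / real n) / 2 = t + ((real j - 1 / 2) / real n) * T" for j
    using assms by (simp add: field_simps)
  then have "(\<Sum>j = 1..n. f_fun T t m (t + real j * (T / real n) - (T / real n) / 2)) =
      (\<Sum>j = 1..n. node m ((real j - 1 / 2) / real n)) * e_fun T m t"
    by (simp only: f_fun_eq_node[OF assms(1)] sum_distrib_right)
  then show ?thesis
    unfolding sum_node_midpoints[OF assms(2)]
    using assms(2) by (simp add: node_sum_eq_B algebra_simps)
qed

theorem theorem2p3:
  fixes a b T t :: real and n :: nat
  assumes "a < b" and "T = b - a" and "t \<in> {a<..<b}" and "n > 0"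
  shows "(\<forall>m :: int.
      quad0 T t n (f_fun T t m) =
        \<i> * of_real (T / real n)
          * of_real (B m n - 2 / 3 * of_int m * real n ^ 2 - 4 / 3 * of_int m ^ 3) * e_fun T m t
    \<and> quad1 T t n (f_fun T t m) =
        \<i> * of_real (T / real n)
          * of_real ((B m (2 * n) - B m n) - 2 * of_int m * real n ^ 2) * e_fun T m t
    \<and> quad2 T t n (f_fun T t m) =
        \<i> * of_real (T / real n)
          * of_real (2 * (B m (2 * n) - B m n) - 1 / 2 * (B m (4 * n) - B m (2 * n))) * e_fun T m t)
    \<and> (\<forall>m :: int. \<bar>B m n\<bar> \<le> Max ((\<lambda>i. \<bar>B (int i) n\<bar>) ` {0..n - 1}))
    \<and> bounded (range (\<lambda>m :: int. B m n))"
proof (intro conjI allI)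
  fix m :: int
  define e where "e = e_fun T m t"
  have T: "T > 0"
    using assms by simp
  note deriv = nth_vector_derivative_regular_part[OF T, of t m, folded e_def]
  note midpoints = sum_f_fun_midpoints[OF T, of _ t m, folded e_def]
  have n: "complex_of_nat n \<noteq> 0" and pi: "complex_of_real pi \<noteq> 0" and T': "complex_of_real T \<noteq> 0"
    using assms(4) T by simp_all
  \<comment> \<open>Up to the common factor i (T / n) e_m(t), the derivative terms are -(2/3) m n^2
    and -(4/3) m^3 here, and -2 m n^2 in \<open>quad1\<close>.\<close>
  show "quad0 T t n (f_fun T t m) =
        \<i> * of_real (T / real n)
          * of_real (B m n - 2 / 3 * of_int m * real n ^ 2 - 4 / 3 * of_int m ^ 3) * e_fun T m t"
    unfolding quad0_def Let_def deriv sum_f_fun_nodes[OF T] node_sum_eq_B[OF assms(4)] e_def[symmetric]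
    using n pi T' by (simp add: field_simps power2_eq_square)
  show "quad1 T t n (f_fun T t m) =
        \<i> * of_real (T / real n)
          * of_real ((B m (2 * n) - B m n) - 2 * of_int m * real n ^ 2) * e_fun T m t"
    unfolding quad1_def Let_def deriv midpoints[OF assms(4)] e_def[symmetric]
    using n pi T' by (simp add: field_simps power2_eq_square)
  \<comment> \<open>With step h / 2 these are the midpoints for 2 n subintervals, so the midpoint
    formula applies with 2 n in place of n.\<close>
  have quarter_points: "(\<Sum>j = 1..2 * n. f_fun T t m (t + real j * (T / real n) / 2 - (T / real n) / 4)) =
      \<i> * of_real (B m (4 * n) - B m (2 * n)) * e"
  proof -
    have eq: "t + real j * (T / real n) / 2 - (T / real n) / 4 =
        t + real j * (T / real (2 * n)) - T / real (2 * n) / 2" for j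
      by simp
    show ?thesis
      unfolding eq using midpoints[of "2 * n"] assms(4) by simp
  qed
  show "quad2 T t n (f_fun T t m) =
        \<i> * of_real (T / real n)
          * of_real (2 * (B m (2 * n) - B m n) - 1 / 2 * (B m (4 * n) - B m (2 * n))) * e_fun T m t"
    unfolding quad2_def Let_def quarter_points midpoints[OF assms(4)] e_def[symmetric]
    using n by (simp add: field_simps)
next
  show "\<bar>B m n\<bar> \<le> Max ((\<lambda>i. \<bar>B (int i) n\<bar>) ` {0..n - 1})" for m
    using assms(4) by (rule abs_B_le_Max)
  then show "bounded (range (\<lambda>m :: int. B m n))"
    by (auto simp: bounded_iff)
qed

end
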